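(* Let $D\in\mathbb{R}^{n\times n}$ be symmetric, let $u_1,\dots,u_{n_1}\in\mathbb{R}^n$ and $v_1,\dots,v_{n_2}\in\mathbb{R}^n$, and suppose that $H = D+\sum_{i=1}^{n_1}u_iu_i^\top-\sum_{j=1}^{n_2}v_jv_j^\top$ is augmented-sparse, i.e. $D-\sum_{j=1}^{n_2}v_jv_j^\top\succ 0$ (with $D$ sparse and $n_1,n_2\ll n$). Then the corresponding augmented sparse matrix $$H_{\mathrm{aug}}=\begin{bmatrix} D & V & U\\ V^\top & I_{n_2} & 0\\ U^\top & 0 & -I_{n_1}\end{bmatrix},\qquad V=[v_1,\dots,v_{n_2}],\quad U=[u_1,\dots,u_{n_1}],$$ is quasidefinite.
   Context: A symmetric matrix is quasidefinite if (with respect to a block partition of its rows and columns, up to symmetric permutation) it has the form $\begin{bmatrix} E & F\\ F^\top & -G\end{bmatrix}$ with $E$ and $G$ symmetric positive definite. Here the partition is into the first $n+n_2$ and the last $n_1$ rows and columns. $\succ 0$ means symmetric positive definite. The conditions "$D$ sparse" and "$n_1,n_2\ll n$" in the definition of augmented-sparse are informal (qualitative) requirements; the precise requirement is $D-\sum_{j}v_jv_j^\top\succ0$. *)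

theory Defs
  imports "Jordan_Normal_Form.Determinant" "HOL-Combinatorics.Permutations"
begin

text \<open>Matrices carry their dimensions explicitly, so that \<open>n\<close>, \<open>n1\<close>, \<open>n2\<close> are arbitrary natural
  numbers and blocks may be empty. Indices start at 0.\<close>

definition sym_pos_def :: "nat \<Rightarrow> real mat \<Rightarrow> bool" where
  "sym_pos_def n A \<longleftrightarrow>
     A \<in> carrier_mat n n \<and> transpose_mat A = A \<and>
     (\<forall>x \<in> carrier_vec n. x \<noteq> 0\<^sub>v n \<longrightarrow> x \<bullet> (A *\<^sub>v x) > 0)"

definition quasidefinite_wrt :: "nat \<Rightarrow> nat \<Rightarrow> real mat \<Rightarrow> bool" where
  "quasidefinite_wrt p q M \<longleftrightarrow>
     (\<exists>E F G. sym_pos_def p E \<and> sym_pos_def q G \<and> F \<in> carrier_mat p q \<and>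
        M = four_block_mat E F (transpose_mat F) (- G))"

definition quasidefinite :: "nat \<Rightarrow> real mat \<Rightarrow> bool" where
  "quasidefinite N M \<longleftrightarrow>
     M \<in> carrier_mat N N \<and>
     (\<exists>p q \<pi>. p + q = N \<and> \<pi> permutes {..<N} \<and>
        quasidefinite_wrt p q (mat N N (\<lambda>(i, j). M $$ (\<pi> i, \<pi> j))))"

definition outer_self :: "real vec \<Rightarrow> real mat" where
  "outer_self w = mat_of_cols (dim_vec w) [w] * transpose_mat (mat_of_cols (dim_vec w) [w])"

definition sum_outer :: "nat \<Rightarrow> nat \<Rightarrow> (nat \<Rightarrow> real vec) \<Rightarrow> real mat" where
  "sum_outer n k w = finsum (module_mat TYPE(real) n n) (\<lambda>i. outer_self (w i)) {..<k}"

text \<open>\<open>H\<close> is augmented-sparse through the given data. The requirements that \<open>D\<close> be sparse and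
  that \<open>n1\<close>, \<open>n2\<close> be much smaller than \<open>n\<close> are qualitative and impose no condition here.\<close>

definition augmented_sparse ::
  "nat \<Rightarrow> nat \<Rightarrow> nat \<Rightarrow> real mat \<Rightarrow> (nat \<Rightarrow> real vec) \<Rightarrow> (nat \<Rightarrow> real vec) \<Rightarrow> real mat \<Rightarrow> bool" where
  "augmented_sparse n n1 n2 D u v H \<longleftrightarrow>
     H = D + sum_outer n n1 u - sum_outer n n2 v \<and>
     sym_pos_def n (D - sum_outer n n2 v)"

definition append_cols :: "real mat \<Rightarrow> real mat \<Rightarrow> real mat" (infixr \<open>@\<^sub>c\<close> 66) where
  "A @\<^sub>c B = four_block_mat A B (0\<^sub>m 0 (dim_col A)) (0\<^sub>m 0 (dim_col B))"

definition H_aug ::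
  "nat \<Rightarrow> nat \<Rightarrow> nat \<Rightarrow> real mat \<Rightarrow> (nat \<Rightarrow> real vec) \<Rightarrow> (nat \<Rightarrow> real vec) \<Rightarrow> real mat" where
  "H_aug n n1 n2 D u v =
     (let U = mat_of_cols n (map u [0..<n1]);
          V = mat_of_cols n (map v [0..<n2])
      in (D               @\<^sub>c V          @\<^sub>c U) @\<^sub>r
         (transpose_mat V @\<^sub>c 1\<^sub>m n2      @\<^sub>c 0\<^sub>m n2 n1) @\<^sub>r
         (transpose_mat U @\<^sub>c 0\<^sub>m n1 n2 @\<^sub>c (- 1\<^sub>m n1)))"

end

theory Submission
  imports Defs
begin

text \<open>
  With the partition into the first \<open>n + n2\<close> and the last \<open>n1\<close> indices, the lower right block of
  the augmented matrix is \<open>- 1\<^sub>m n1\<close>, and the identity is positive definite. What has to be shown is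
  that the upper left block, with rows \<open>(D, V)\<close> and \<open>(V\<^sup>T, I)\<close>, is positive definite. Completing the
  square in the second component turns its quadratic form at \<open>(y, z)\<close> into
  \<open>y \<bullet> (D - V V\<^sup>T) y + (V\<^sup>T y + z) \<bullet> (V\<^sup>T y + z)\<close>, so everything rests on its Schur
  complement \<open>D - V V\<^sup>T\<close> (\<open>quadratic_form_complete_square\<close>, \<open>sym_pos_def_four_block_one\<close>). Since \<open>V V\<^sup>T\<close> is the sum of the
  outer products of the columns of \<open>V\<close> (\<open>sum_outer_eq_mult_transpose\<close>), this Schur complement is
  precisely the matrix that augmented sparsity requires to be positive definite. The block \<open>U\<close>
  enters only the off-diagonal block, where quasidefiniteness imposes no condition, and the
  partition is the given one, so the identity permutation suffices.
\<close>

lemma outer_self_carrier [simp]: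
  "w \<in> carrier_vec n \<Longrightarrow> outer_self w \<in> carrier_mat n n"
  unfolding outer_self_def by auto

lemma outer_self_index:
  assumes "w \<in> carrier_vec n" "i < n" "j < n"
  shows "outer_self w $$ (i, j) = w $ i * w $ j"
  using assms unfolding outer_self_def
  by (simp add: scalar_prod_def mat_of_cols_index)

lemma sum_outer_0: "sum_outer n 0 w = 0\<^sub>m n n"
proof -
  interpret abelian_group "module_mat TYPE(real) n n" by (rule abelian_group_mat)
  show ?thesis by (simp add: sum_outer_def module_mat_simps)
qed

lemma sum_outer_Suc:
  assumes "\<And>l. l < Suc k \<Longrightarrow> w l \<in> carrier_vec n"
  shows "sum_outer n (Suc k) w = outer_self (w k) + sum_outer n k w"
proof -
  interpret abelian_group "module_mat TYPE(real) n n" by (rule abelian_group_mat)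
  have "finsum (module_mat TYPE(real) n n) (\<lambda>i. outer_self (w i)) (insert k {..<k})
      = outer_self (w k) + finsum (module_mat TYPE(real) n n) (\<lambda>i. outer_self (w i)) {..<k}"
    by (subst finsum_insert) (use assms in \<open>auto simp: module_mat_simps less_Suc_eq\<close>)
  then show ?thesis by (simp add: sum_outer_def lessThan_Suc)
qed

lemma sum_outer_carrier_index:
  assumes "\<And>l. l < k \<Longrightarrow> w l \<in> carrier_vec n"
  shows "sum_outer n k w \<in> carrier_mat n n
    \<and> (\<forall>i<n. \<forall>j<n. sum_outer n k w $$ (i, j) = (\<Sum>l<k. w l $ i * w l $ j))"
  using assms
proof (induction k)
  case 0
  then show ?case by (simp add: sum_outer_0)
next
  case (Suc k)
  then have IH: "sum_outer n k w \<in> carrier_mat n n"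
      "\<forall>i<n. \<forall>j<n. sum_outer n k w $$ (i, j) = (\<Sum>l<k. w l $ i * w l $ j)"
    by auto
  show ?case
    using IH Suc.prems
    by (simp add: sum_outer_Suc outer_self_index[of _ n])
qed

lemma sum_outer_eq_mult_transpose:
  assumes "\<And>l. l < k \<Longrightarrow> w l \<in> carrier_vec n"
  defines "W \<equiv> mat_of_cols n (map w [0..<k])"
  shows "sum_outer n k w = W * transpose_mat W"
proof -
  have "sum_outer n k w \<in> carrier_mat n n"
    and "\<forall>i<n. \<forall>j<n. sum_outer n k w $$ (i, j) = (\<Sum>l<k. w l $ i * w l $ j)"
    using sum_outer_carrier_index[of k w n] assms(1) by blast+
  then show ?thesis
    by (intro eq_matI)
       (auto simp: W_def scalar_prod_def mat_of_cols_index lessThan_atLeast0 intro!: sum.cong)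
qed

lemma sym_pos_def_one: "sym_pos_def n (1\<^sub>m n)"
proof -
  have "x \<bullet> x > 0" if "x \<in> carrier_vec n" "x \<noteq> 0\<^sub>v n" for x :: "real vec"
    using conjugate_square_greater_0_vec[OF that(1)] that by simp
  then show ?thesis unfolding sym_pos_def_def by auto
qed

text \<open>Expanding the left-hand side gives \<open>y \<bullet> A y + 2 (B\<^sup>T y \<bullet> z) + z \<bullet> z\<close>; adding and subtracting
  \<open>B\<^sup>T y \<bullet> B\<^sup>T y = y \<bullet> B B\<^sup>T y\<close> completes the square in \<open>z\<close>.\<close>

lemma quadratic_form_complete_square:
  fixes A B :: "real mat"
  assumes A: "A \<in> carrier_mat n n" and B: "B \<in> carrier_mat n m"
    and y: "y \<in> carrier_vec n" and z: "z \<in> carrier_vec m"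
  shows "(y @\<^sub>v z) \<bullet> (four_block_mat A B (transpose_mat B) (1\<^sub>m m) *\<^sub>v (y @\<^sub>v z))
    = y \<bullet> ((A - B * transpose_mat B) *\<^sub>v y)
      + (transpose_mat B *\<^sub>v y + z) \<bullet> (transpose_mat B *\<^sub>v y + z)"
proof -
  define w where "w = transpose_mat B *\<^sub>v y"
  have w: "w \<in> carrier_vec m" using B y by (simp add: w_def)
  have Ay: "A *\<^sub>v y \<in> carrier_vec n" and Bz: "B *\<^sub>v z \<in> carrier_vec n"
    and Bw: "B *\<^sub>v w \<in> carrier_vec n"
    using A B y z w by auto
  have adjoint: "y \<bullet> (B *\<^sub>v x) = w \<bullet> x" if "x \<in> carrier_vec m" for x
    using transpose_vec_mult_scalar[OF B that y] by (simp add: w_def)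
  have "four_block_mat A B (transpose_mat B) (1\<^sub>m m) *\<^sub>v (y @\<^sub>v z)
      = (A *\<^sub>v y + B *\<^sub>v z) @\<^sub>v (w + z)"
    using four_block_mat_mult_vec[OF A B _ _ y z, of "transpose_mat B" m "1\<^sub>m m"] B z
    by (simp add: w_def)
  then have "(y @\<^sub>v z) \<bullet> (four_block_mat A B (transpose_mat B) (1\<^sub>m m) *\<^sub>v (y @\<^sub>v z))
      = y \<bullet> (A *\<^sub>v y + B *\<^sub>v z) + z \<bullet> (w + z)"
    using scalar_prod_append[OF y z, of "A *\<^sub>v y + B *\<^sub>v z" "w + z"] Ay Bz w z by simp
  also have "\<dots> = y \<bullet> (A *\<^sub>v y) + w \<bullet> z + (w \<bullet> z + z \<bullet> z)"
    by (simp add: scalar_prod_add_distrib[OF y Ay Bz] scalar_prod_add_distrib[OF z w z]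
        adjoint[OF z] comm_scalar_prod[OF z w])
  also have "\<dots> = (y \<bullet> (A *\<^sub>v y) - w \<bullet> w) + (w + z) \<bullet> (w + z)"
    using w z
    by (simp add: scalar_prod_add_distrib[of _ m] add_scalar_prod_distrib[of _ m]
        comm_scalar_prod[OF z w])
  also have "y \<bullet> (A *\<^sub>v y) - w \<bullet> w = y \<bullet> ((A - B * transpose_mat B) *\<^sub>v y)"
  proof -
    have "(A - B * transpose_mat B) *\<^sub>v y = A *\<^sub>v y - (B * transpose_mat B) *\<^sub>v y"
      by (rule minus_mult_distrib_mat_vec) (use A B y in auto)
    also have "(B * transpose_mat B) *\<^sub>v y = B *\<^sub>v w"
      unfolding w_def by (rule assoc_mult_mat_vec) (use B y in auto)
    finally show ?thesis
      by (simp add: scalar_prod_minus_distrib[OF y Ay Bw] adjoint[OF w])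
  qed
  finally show ?thesis by (simp add: w_def)
qed

text \<open>Both terms of the completed square are nonnegative. For \<open>y \<noteq> 0\<close> the first is positive, and for
  \<open>y = 0\<close> the second is \<open>z \<bullet> z\<close>.\<close>

lemma sym_pos_def_four_block_one:
  fixes A B :: "real mat"
  assumes A: "A \<in> carrier_mat n n" "transpose_mat A = A" and B: "B \<in> carrier_mat n m"
    and schur: "sym_pos_def n (A - B * transpose_mat B)"
  shows "sym_pos_def (n + m) (four_block_mat A B (transpose_mat B) (1\<^sub>m m))" (is "sym_pos_def _ ?M")
proof -
  have carrier: "?M \<in> carrier_mat (n + m) (n + m)" using A by auto
  have symmetric: "transpose_mat ?M = ?M"
    using transpose_four_block_mat[OF A(1) B, of "transpose_mat B" m "1\<^sub>m m"] A B by simp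
  have "x \<bullet> (?M *\<^sub>v x) > 0" if x: "x \<in> carrier_vec (n + m)" "x \<noteq> 0\<^sub>v (n + m)" for x
  proof -
    define y z where "y = vec_first x n" and "z = vec_last x m"
    have y: "y \<in> carrier_vec n" and z: "z \<in> carrier_vec m" and xyz: "x = y @\<^sub>v z"
      using x by (simp_all add: y_def z_def)
    let ?r = "transpose_mat B *\<^sub>v y + z"
    have r: "?r \<in> carrier_vec m" using B y z by auto
    have r_nonneg: "?r \<bullet> ?r \<ge> 0" by (simp add: scalar_prod_def sum_nonneg)
    have form: "x \<bullet> (?M *\<^sub>v x) = y \<bullet> ((A - B * transpose_mat B) *\<^sub>v y) + ?r \<bullet> ?r"
      unfolding xyz by (rule quadratic_form_complete_square[OF A(1) B y z])
    show ?thesis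
    proof (cases "y = 0\<^sub>v n")
      case False
      then have "y \<bullet> ((A - B * transpose_mat B) *\<^sub>v y) > 0"
        using schur y unfolding sym_pos_def_def by blast
      then show ?thesis using form r_nonneg by linarith
    next
      case True
      then have "z \<noteq> 0\<^sub>v m" using x xyz by auto
      then have "z \<bullet> z > 0"
        using sym_pos_def_one[of m] z unfolding sym_pos_def_def by auto
      moreover have "?r = z"
        using True B z by (intro eq_vecI) auto
      moreover have "y \<bullet> ((A - B * transpose_mat B) *\<^sub>v y) = 0"
      proof -
        have "(A - B * transpose_mat B) *\<^sub>v y \<in> carrier_vec n"
          by (rule mult_mat_vec_carrier[OF _ y]) (use A B in auto)
        then show ?thesis using True by simp
      qed
      ultimately show ?thesis using form by simp
    qed
  qed
  then show ?thesis using carrier symmetric unfolding sym_pos_def_def by blast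
qed

lemma quasidefinite_wrt_imp_quasidefinite:
  assumes "quasidefinite_wrt p q M"
  shows "quasidefinite (p + q) M"
proof -
  have M: "M \<in> carrier_mat (p + q) (p + q)"
    using assms unfolding quasidefinite_wrt_def sym_pos_def_def by auto
  then have "mat (p + q) (p + q) (\<lambda>(i, j). M $$ (id i, id j)) = M"
    by (intro eq_matI) auto
  then show ?thesis
    unfolding quasidefinite_def using M assms permutes_id by metis
qed

text \<open>The \<open>3 \<times> 3\<close> block layout read as a \<open>2 \<times> 2\<close> one: the first two block rows and columns are
  merged, and the off-diagonal block becomes \<open>U\<close> stacked on zeros.\<close>

lemma H_aug_eq_four_block_mat:
  fixes u v :: "nat \<Rightarrow> real vec" and n n1 n2 :: nat
  assumes D: "D \<in> carrier_mat n n"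
  defines "U \<equiv> mat_of_cols n (map u [0..<n1])"
    and "V \<equiv> mat_of_cols n (map v [0..<n2])"
  shows "H_aug n n1 n2 D u v =
    four_block_mat (four_block_mat D V (transpose_mat V) (1\<^sub>m n2)) (U @\<^sub>r 0\<^sub>m n2 n1)
      (transpose_mat (U @\<^sub>r 0\<^sub>m n2 n1)) (- 1\<^sub>m n1)"
proof -
  have U: "U \<in> carrier_mat n n1" and V: "V \<in> carrier_mat n n2"
    unfolding U_def V_def by auto
  show ?thesis
    unfolding H_aug_def Let_def U_def[symmetric] V_def[symmetric]
    using D U V by (intro eq_matI) (auto simp: append_cols_def append_rows_def)
qed

theorem lemma1:
  fixes n n1 n2 :: nat
    and D H :: "real mat"
    and u v :: "nat \<Rightarrow> real vec"
  assumes "D \<in> carrier_mat n n"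
    and "transpose_mat D = D"
    and "\<And>i. i < n1 \<Longrightarrow> u i \<in> carrier_vec n"
    and "\<And>j. j < n2 \<Longrightarrow> v j \<in> carrier_vec n"
    and "augmented_sparse n n1 n2 D u v H"
  shows "quasidefinite_wrt (n + n2) n1 (H_aug n n1 n2 D u v)
    \<and> quasidefinite (n + n2 + n1) (H_aug n n1 n2 D u v)"
proof -
  define U where "U = mat_of_cols n (map u [0..<n1])"
  define V where "V = mat_of_cols n (map v [0..<n2])"
  have "sym_pos_def n (D - V * transpose_mat V)"
    using assms(5) sum_outer_eq_mult_transpose[OF assms(4)]
    unfolding augmented_sparse_def V_def by simp
  then have "sym_pos_def (n + n2) (four_block_mat D V (transpose_mat V) (1\<^sub>m n2))"
    by (intro sym_pos_def_four_block_one assms(1,2)) (auto simp: V_def)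
  moreover have "U @\<^sub>r 0\<^sub>m n2 n1 \<in> carrier_mat (n + n2) n1"
    unfolding U_def by (intro carrier_append_rows) auto
  ultimately have "quasidefinite_wrt (n + n2) n1 (H_aug n n1 n2 D u v)"
    unfolding quasidefinite_wrt_def H_aug_eq_four_block_mat[OF assms(1)]
    using sym_pos_def_one[of n1] unfolding U_def V_def by blast
  then show ?thesis using quasidefinite_wrt_imp_quasidefinite by blast
qed

end
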